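(* Let $f,g:\mathbb{R}^d\to\mathbb{R}$ be differentiable, convex and $L$-smooth ($L>0$), and let $w^\ast$ be a solution of $\min_{w\in\mathbb{R}^d} f(w)$ subject to $g(w)\le 0$. Suppose $\tilde f:=\min_x f(x)>-\infty$ and $\tilde g:=\min_x g(x)>-\infty$, and set $\Delta_{\max}:=\max\{f(w^\ast)-\tilde f,\ g(w^\ast)-\tilde g\}\ge 0$. Let $T\ge 1$ be an integer, $w_1\in\mathbb{R}^d$, $D:=\|w_1-w^\ast\|$, and let the iterates be generated by the switching gradient method with tolerance $\epsilon$ and constant step size $\eta$: $$w_{t+1}=w_t-\eta u_t,\qquad u_t=\begin{cases}\nabla f(w_t), & g(w_t)\le\epsilon,\\ \nabla g(w_t), & g(w_t)>\epsilon.\end{cases}$$ Define $\mathcal{A}=\{t\in\{1,\dots,T\} : g(w_t)\le\epsilon\}$ and $\bar w=\frac{1}{|\mathcal{A}|}\sum_{t\in\mathcal{A}}w_t$. If $$\epsilon=\frac{2LD^2}{T}+\sqrt{\frac{8LD^2\Delta_{\max}}{T}},\qquad \eta=\min\left\{\frac{1}{2L},\ \sqrt{\frac{D^2}{2L\Delta_{\max}T}}\right\},$$ then $\mathcal{A}$ is nonempty, $\bar w$ is well-defined, and $\bar w$ is an $\epsilon$-solution, i.e. $f(\bar w)-f(w^\ast)\le\epsilon$ and $g(\bar w)\le\epsilon$.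
   Context: $\|\cdot\|$ is the Euclidean norm. The tolerance satisfies $\epsilon>0$. A differentiable function $f$ is $L$-smooth if $\|\nabla f(x)-\nabla f(y)\|\le L\|x-y\|$ for all $x,y\in\mathbb{R}^d$. When $\Delta_{\max}=0$, the second term in the minimum defining $\eta$ is read as $+\infty$, so $\eta=1/(2L)$. *)

theory Defs
  imports "HOL-Analysis.Analysis"
begin

text \<open>The gradient as a function; it is meaningful only at points of differentiability
  (see \<open>GDERIV_grad\<close> below).\<close>

definition grad :: "('a::euclidean_space \<Rightarrow> real) \<Rightarrow> 'a \<Rightarrow> 'a" where
  "grad f x = (THE v. GDERIV f x :> v)"

lemma GDERIV_iff_grad:
  fixes f :: "'a::euclidean_space \<Rightarrow> real"
  assumes "f differentiable (at x)"
  shows "GDERIV f x :> v \<longleftrightarrow> v = grad f x"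
proof -
  obtain F where F: "(f has_derivative F) (at x)"
    using assms by (auto simp: differentiable_def)
  then interpret linear F by (rule has_derivative_linear)
  have "F = (\<lambda>h. h \<bullet> adjoint F 1)"
    using adjoint_works[OF linear_axioms, of _ 1] by (simp add: fun_eq_iff)
  then have ex: "GDERIV f x :> adjoint F 1"
    using F by (simp add: gderiv_def)
  have uniq: "v = w" if "GDERIV f x :> v" "GDERIV f x :> w" for v w
  proof -
    have "(\<lambda>h. h \<bullet> v) = (\<lambda>h. h \<bullet> w)"
      using that unfolding gderiv_def by (rule has_derivative_unique)
    then show ?thesis by (metis vector_eq_ldot)
  qed
  have "GDERIV f x :> grad f x"
    unfolding grad_def using ex uniq[OF _ ex] by (rule theI)
  then show ?thesis using uniq by blast
qed

lemma GDERIV_grad: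
  fixes f :: "'a::euclidean_space \<Rightarrow> real"
  shows "f differentiable (at x) \<Longrightarrow> GDERIV f x :> grad f x"
  by (simp add: GDERIV_iff_grad)

text \<open>This is only the Lipschitz condition on the gradient; differentiability is required
  separately wherever it is used.\<close>

definition L_smooth :: "real \<Rightarrow> ('a::euclidean_space \<Rightarrow> real) \<Rightarrow> bool" where
  "L_smooth L f \<longleftrightarrow> (\<forall>x y. norm (grad f x - grad f y) \<le> L * norm (x - y))"

definition switching_direction ::
  "('a::euclidean_space \<Rightarrow> real) \<Rightarrow> ('a \<Rightarrow> real) \<Rightarrow> real \<Rightarrow> 'a \<Rightarrow> 'a" where
  "switching_direction f g \<epsilon> x = (if g x \<le> \<epsilon> then grad f x else grad g x)"

text \<open>Iterates are indexed from 1; the value of the sequence at 0 is irrelevant.\<close>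

definition switching_gradient_iterates ::
  "('a::euclidean_space \<Rightarrow> real) \<Rightarrow> ('a \<Rightarrow> real) \<Rightarrow> real \<Rightarrow> real \<Rightarrow> 'a \<Rightarrow> (nat \<Rightarrow> 'a) \<Rightarrow> bool" where
  "switching_gradient_iterates f g \<epsilon> \<eta> w1 w \<longleftrightarrow>
     w 1 = w1 \<and>
     (\<forall>t\<ge>1. w (t + 1) = w t - \<eta> *\<^sub>R switching_direction f g \<epsilon> (w t))"

definition eps_solution ::
  "('a \<Rightarrow> real) \<Rightarrow> ('a \<Rightarrow> real) \<Rightarrow> 'a \<Rightarrow> real \<Rightarrow> 'a \<Rightarrow> bool" where
  "eps_solution f g wstar \<epsilon> x \<longleftrightarrow> f x - f wstar \<le> \<epsilon> \<and> g x \<le> \<epsilon>"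

end

theory Submission
  imports Defs
begin

text \<open>Let \<open>h\<close> denote the function whose gradient is used at step \<open>t\<close> (either \<open>f\<close> or \<open>g\<close>) and
  \<open>\<delta>\<^sub>t = h (w\<^sub>t) - h (w\<^sup>*)\<close>.  Smoothness gives the self-bounding property
  \<open>\<parallel>\<nabla>h x\<parallel>\<^sup>2 \<le> 2 L (h x - inf h)\<close>.  Together with convexity and telescoping, this yields
  \<open>2 \<eta> (1 - \<eta> L) \<Sum>\<delta>\<^sub>t \<le> D\<^sup>2 + 2 \<eta>\<^sup>2 L \<Delta> T\<close>, and the right-hand side is at most \<open>\<eta> T \<epsilon>\<close> by the
  choice of \<open>\<eta>\<close>; as \<open>1 - \<eta> L \<ge> 1/2\<close>, we get \<open>\<Sum>\<delta>\<^sub>t \<le> T \<epsilon>\<close>.  Steps outside \<open>A\<close> each contribute more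
  than \<open>\<epsilon>\<close>, so \<open>A\<close> is nonempty and the average of \<open>\<delta>\<^sub>t\<close> over \<open>A\<close> is at most \<open>\<epsilon>\<close>; conclude by
  Jensen's inequality.\<close>

text \<open>Chain rule. It reduces tangent and descent bounds for \<open>h\<close> to one-variable
  calculus along a line.\<close>

lemma DERIV_along_line:
  fixes h :: "'a::euclidean_space \<Rightarrow> real"
  assumes "\<And>x. h differentiable (at x)"
  shows "DERIV (\<lambda>s. h (x + s *\<^sub>R d)) s :> grad h (x + s *\<^sub>R d) \<bullet> d"
proof -
  have "(h has_derivative (\<lambda>v. v \<bullet> grad h (x + s *\<^sub>R d))) (at (x + s *\<^sub>R d))"
    using GDERIV_grad[OF assms] by (simp add: gderiv_def)
  moreover have "((\<lambda>s. x + s *\<^sub>R d) has_derivative (\<lambda>s. s *\<^sub>R d)) (at s)"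
    by (auto intro!: derivative_eq_intros)
  ultimately have "((\<lambda>s. h (x + s *\<^sub>R d)) has_derivative
      (\<lambda>u. (u *\<^sub>R d) \<bullet> grad h (x + s *\<^sub>R d))) (at s)"
    by (rule has_derivative_compose[rotated])
  then show ?thesis
    by (simp add: has_field_derivative_def inner_commute mult_commute_abs)
qed

text \<open>The restriction of \<open>h\<close> to the line from \<open>x\<close> to
  \<open>y\<close> is convex, so its value at parameter 1 lies above its tangent at parameter
  0.\<close>

lemma convex_on_gradient_inequality:
  fixes h :: "'a::euclidean_space \<Rightarrow> real"
  assumes diff: "\<And>x. h differentiable (at x)" and conv: "convex_on UNIV h"
  shows "h x - h y \<le> grad h x \<bullet> (x - y)"
proof -
  have "convex_on UNIV (\<lambda>s. h (x + s *\<^sub>R (y - x)))"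
  proof (rule convex_onI)
    fix t a b :: real
    assume "0 < t" "t < 1"
    moreover have "x + ((1 - t) *\<^sub>R a + t *\<^sub>R b) *\<^sub>R (y - x)
      = (1 - t) *\<^sub>R (x + a *\<^sub>R (y - x)) + t *\<^sub>R (x + b *\<^sub>R (y - x))"
      by (simp add: algebra_simps)
    ultimately show "h (x + ((1 - t) *\<^sub>R a + t *\<^sub>R b) *\<^sub>R (y - x))
      \<le> (1 - t) * h (x + a *\<^sub>R (y - x)) + t * h (x + b *\<^sub>R (y - x))"
      using convex_onD[OF conv] by simp
  qed simp
  from convex_on_imp_above_tangent[OF this _ _ _ DERIV_along_line[OF diff], of 0 1]
  show ?thesis by (simp add: inner_diff_right)
qed

lemma L_smooth_descent:
  fixes h :: "'a::euclidean_space \<Rightarrow> real"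
  assumes diff: "\<And>x. h differentiable (at x)" and smooth: "L_smooth L h"
  shows "h (x + d) \<le> h x + grad h x \<bullet> d + L / 2 * (norm d)\<^sup>2"
proof -
  \<comment> \<open>The non-constant part of the quadratic model is subtracted along the segment. By
    Cauchy-Schwarz and the Lipschitz gradient the remainder has nonpositive slope on [0, 1], which
    replaces integrating the gradient.\<close>
  let ?\<phi> = "\<lambda>s. h (x + s *\<^sub>R d) - s * (grad h x \<bullet> d) - L / 2 * s\<^sup>2 * (norm d)\<^sup>2"
  have "?\<phi> 1 \<le> ?\<phi> 0"
  proof (rule DERIV_nonpos_imp_nonincreasing[of 0 1 ?\<phi>])
    fix s :: real
    assume "0 \<le> s" "s \<le> 1"
    have "DERIV ?\<phi> s :> grad h (x + s *\<^sub>R d) \<bullet> d - grad h x \<bullet> d - L * s * (norm d)\<^sup>2"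
      by (auto intro!: derivative_eq_intros DERIV_along_line[OF diff])
    moreover have "(grad h (x + s *\<^sub>R d) - grad h x) \<bullet> d \<le> L * s * (norm d)\<^sup>2"
    proof -
      have "(grad h (x + s *\<^sub>R d) - grad h x) \<bullet> d \<le> norm (grad h (x + s *\<^sub>R d) - grad h x) * norm d"
        by (rule norm_cauchy_schwarz)
      also have "\<dots> \<le> (L * norm (x + s *\<^sub>R d - x)) * norm d"
        using smooth unfolding L_smooth_def by (intro mult_right_mono) (blast, simp)
      finally show ?thesis
        using \<open>0 \<le> s\<close> by (simp add: power2_eq_square mult.assoc)
    qed
    ultimately show "\<exists>y. DERIV ?\<phi> s :> y \<and> y \<le> 0"
      by (auto simp: inner_diff_left)
  qed simp
  then show ?thesis by simp
qed

text \<open>A gradient step of length \<open>1 / L\<close> minimizes the quadratic upper model and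
  lowers \<open>h\<close> by at least the squared gradient norm over \<open>2 * L\<close>; it cannot
  pass below the infimum.\<close>

lemma norm_grad_le_suboptimality:
  fixes h :: "'a::euclidean_space \<Rightarrow> real"
  assumes "L > 0" and diff: "\<And>x. h differentiable (at x)" and smooth: "L_smooth L h"
    and bdd: "bdd_below (range h)"
  shows "(norm (grad h x))\<^sup>2 \<le> 2 * L * (h x - (INF x. h x))"
proof -
  have "(INF x. h x) \<le> h (x + (- (1 / L)) *\<^sub>R grad h x)"
    using bdd by (rule cINF_lower) simp
  also have "\<dots> \<le> h x - (norm (grad h x))\<^sup>2 / (2 * L)"
    using L_smooth_descent[OF diff smooth, of x "(- (1 / L)) *\<^sub>R grad h x"] \<open>L > 0\<close>
    by (simp add: power2_norm_eq_inner[symmetric] power_divide power_mult_distrib field_simps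
        power2_eq_square)
  finally show ?thesis using \<open>L > 0\<close> by (simp add: field_simps)
qed

text \<open>Expand the squared distance after the step. The squared gradient norm is controlled by
  the gap of \<open>x\<close> to the infimum, split at \<open>h z\<close>: the part
  \<open>h x - h z\<close>, whatever its sign, moves to the left and produces the factor
  \<open>1 - \<eta> * L\<close>; the rest is at most \<open>\<Delta>\<close>.\<close>

lemma gradient_step_progress:
  fixes h :: "'a::euclidean_space \<Rightarrow> real"
  assumes "L > 0" "\<eta> \<ge> 0" and diff: "\<And>x. h differentiable (at x)" and conv: "convex_on UNIV h"
    and smooth: "L_smooth L h" and bdd: "bdd_below (range h)"
    and \<Delta>: "h z - (INF x. h x) \<le> \<Delta>"
  shows "2 * \<eta> * (1 - \<eta> * L) * (h x - h z)
    \<le> (norm (x - z))\<^sup>2 - (norm (x - \<eta> *\<^sub>R grad h x - z))\<^sup>2 + 2 * \<eta>\<^sup>2 * L * \<Delta>"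
proof -
  have "(norm (x - \<eta> *\<^sub>R grad h x - z))\<^sup>2
      = (norm (x - z))\<^sup>2 - 2 * \<eta> * (grad h x \<bullet> (x - z)) + \<eta>\<^sup>2 * (norm (grad h x))\<^sup>2"
    unfolding power2_norm_eq_inner
    by (simp add: algebra_simps inner_commute power2_eq_square)
  moreover have "\<eta> * (h x - h z) \<le> \<eta> * (grad h x \<bullet> (x - z))"
    using convex_on_gradient_inequality[OF diff conv] \<open>\<eta> \<ge> 0\<close> by (rule mult_left_mono)
  moreover have "\<eta>\<^sup>2 * (norm (grad h x))\<^sup>2 \<le> \<eta>\<^sup>2 * (2 * L * ((h x - h z) + \<Delta>))"
  proof (rule mult_left_mono)
    have "(norm (grad h x))\<^sup>2 \<le> 2 * L * (h x - (INF x. h x))"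
      by (rule norm_grad_le_suboptimality[OF \<open>L > 0\<close> diff smooth bdd])
    also have "\<dots> \<le> 2 * L * ((h x - h z) + \<Delta>)"
      using \<Delta> \<open>L > 0\<close> by (intro mult_left_mono) auto
    finally show "(norm (grad h x))\<^sup>2 \<le> 2 * L * ((h x - h z) + \<Delta>)" .
  qed simp
  ultimately show ?thesis
    by (simp add: algebra_simps power2_eq_square)
qed

lemma step_size_tolerance:
  fixes L D \<Delta> T :: real
  assumes "L > 0" "D > 0" "\<Delta> \<ge> 0" "T > 0"
    and \<epsilon>: "\<epsilon> = 2 * L * D\<^sup>2 / T + sqrt (8 * L * D\<^sup>2 * \<Delta> / T)"
    and \<eta>: "\<eta> = (if \<Delta> = 0 then 1 / (2 * L)
              else min (1 / (2 * L)) (sqrt (D\<^sup>2 / (2 * L * \<Delta> * T))))"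
  shows "\<eta> > 0" "\<eta> * L \<le> 1 / 2" "D\<^sup>2 + 2 * \<eta>\<^sup>2 * L * \<Delta> * T \<le> \<eta> * T * \<epsilon>"
proof -
  show "\<eta> > 0" using assms by auto
  have "\<eta> \<le> 1 / (2 * L)" using \<eta> by auto
  then show "\<eta> * L \<le> 1 / 2" using \<open>L > 0\<close> by (simp add: field_simps)
  show "D\<^sup>2 + 2 * \<eta>\<^sup>2 * L * \<Delta> * T \<le> \<eta> * T * \<epsilon>"
  proof (cases "\<Delta> = 0")
    case True
    then show ?thesis using assms by simp
  next
    case False
    then have "\<Delta> > 0" using \<open>\<Delta> \<ge> 0\<close> by simp
    \<comment> \<open>The step size that balances the two error terms,
      \<open>D\<^sup>2 = 2 * L * \<Delta> * T * r\<^sup>2\<close>. In terms of \<open>r\<close> the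
      square root in \<open>\<epsilon>\<close> is simply
      \<open>4 * L * \<Delta> * r\<close>.\<close>
    define r where "r = sqrt (D\<^sup>2 / (2 * L * \<Delta> * T))"
    have "r > 0" unfolding r_def using assms \<open>\<Delta> > 0\<close> by simp
    have "r\<^sup>2 = D\<^sup>2 / (2 * L * \<Delta> * T)"
      unfolding r_def using assms \<open>\<Delta> > 0\<close> by simp
    then have D2: "D\<^sup>2 = 2 * L * \<Delta> * T * r\<^sup>2"
      using assms \<open>\<Delta> > 0\<close> by (simp add: field_simps)
    have "8 * L * D\<^sup>2 * \<Delta> / T = (4 * L * \<Delta> * r)\<^sup>2"
      unfolding D2 using \<open>T > 0\<close> by (simp add: power2_eq_square)
    then have "sqrt (8 * L * D\<^sup>2 * \<Delta> / T) = 4 * L * \<Delta> * r"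
      using assms \<open>\<Delta> > 0\<close> \<open>r > 0\<close> by (simp add: real_sqrt_unique)
    then have T\<epsilon>: "T * \<epsilon> = 2 * L * D\<^sup>2 + 4 * L * \<Delta> * T * r"
      unfolding \<epsilon> using \<open>T > 0\<close> by (simp add: field_simps)
    consider "\<eta> = 1 / (2 * L)" "\<eta> \<le> r" | "\<eta> = r"
      using \<eta> False unfolding r_def[symmetric] by (auto simp: min_def split: if_splits)
    then show ?thesis
    proof cases
      \<comment> \<open>The first summand of \<open>\<epsilon>\<close> yields exactly
        \<open>D\<^sup>2\<close>; the second covers the remaining error because
        \<open>\<eta> \<le> r\<close>.\<close>
      case 1
      have "\<eta> * T * \<epsilon> = D\<^sup>2 + 2 * \<Delta> * T * r"
        unfolding mult.assoc T\<epsilon> 1(1) using \<open>L > 0\<close> by (simp add: field_simps)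
      moreover have "2 * \<eta>\<^sup>2 * L * \<Delta> * T = \<Delta> * T * \<eta>"
        using 1(1) \<open>L > 0\<close> by (simp add: power2_eq_square)
      moreover have "\<Delta> * T * \<eta> \<le> 2 * \<Delta> * T * r"
        using 1(2) \<open>\<Delta> > 0\<close> \<open>T > 0\<close> \<open>r > 0\<close> by (simp add: mult.assoc)
      ultimately show ?thesis by linarith
    next
      \<comment> \<open>By the balance, the left-hand side is
        \<open>4 * L * \<Delta> * T * r\<^sup>2\<close>, which the second summand of
        \<open>\<epsilon>\<close> supplies alone.\<close>
      case 2
      have "\<eta> * T * \<epsilon> = 2 * L * D\<^sup>2 * r + 4 * L * \<Delta> * T * r\<^sup>2"
        using T\<epsilon> 2 by (simp add: mult.assoc) (simp add: algebra_simps power2_eq_square)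
      moreover have "2 * L * D\<^sup>2 * r \<ge> 0" using \<open>L > 0\<close> \<open>r > 0\<close> by simp
      ultimately show ?thesis unfolding 2 D2 by simp
    qed
  qed
qed

text \<open>Jensen's inequality with uniform weights.\<close>

lemma convex_on_average_le:
  fixes h :: "'a::real_vector \<Rightarrow> real"
  assumes "convex_on UNIV h" "finite A" "A \<noteq> {}" "(\<Sum>t\<in>A. h (w t)) \<le> real (card A) * c"
  shows "h ((1 / real (card A)) *\<^sub>R (\<Sum>t\<in>A. w t)) \<le> c"
proof -
  have card: "real (card A) > 0" using assms by (simp add: card_gt_0_iff)
  have "h (\<Sum>t\<in>A. (1 / real (card A)) *\<^sub>R w t) \<le> (\<Sum>t\<in>A. 1 / real (card A) * h (w t))"
    using assms card by (intro convex_on_sum) auto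
  also have "\<dots> \<le> c"
    using assms(4) card by (simp add: sum_divide_distrib[symmetric] divide_le_eq mult.commute)
  finally show ?thesis by (simp add: scaleR_right.sum)
qed

theorem theorem2:
  fixes f g :: "real ^ 'd \<Rightarrow> real"
    and w :: "nat \<Rightarrow> real ^ 'd"
    and w1 wstar wbar :: "real ^ 'd"
    and L D \<epsilon> \<eta> ftilde gtilde \<Delta>max :: real
    and T :: nat
    and A :: "nat set"
  assumes "L > 0"
    and "\<And>x. f differentiable (at x)" and "convex_on UNIV f" and "L_smooth L f"
    and "\<And>x. g differentiable (at x)" and "convex_on UNIV g" and "L_smooth L g"
    and "is_arg_min f (\<lambda>x. g x \<le> 0) wstar"
    and "bdd_below (range f)" and "ftilde = (INF x. f x)"
    and "bdd_below (range g)" and "gtilde = (INF x. g x)"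
    and "\<Delta>max = max (f wstar - ftilde) (g wstar - gtilde)"
    and "T \<ge> 1"
    and "D = norm (w1 - wstar)"
    and "\<epsilon> > 0"
    and "\<epsilon> = 2 * L * D\<^sup>2 / real T + sqrt (8 * L * D\<^sup>2 * \<Delta>max / real T)"
    and "\<eta> = (if \<Delta>max = 0 then 1 / (2 * L)
              else min (1 / (2 * L)) (sqrt (D\<^sup>2 / (2 * L * \<Delta>max * real T))))"
    and "switching_gradient_iterates f g \<epsilon> \<eta> w1 w"
    and "A = {t \<in> {1..T}. g (w t) \<le> \<epsilon>}"
    and "wbar = (1 / real (card A)) *\<^sub>R (\<Sum>t\<in>A. w t)"
  shows "A \<noteq> {} \<and> card A > 0 \<and> eps_solution f g wstar \<epsilon> wbar"
proof -
  note diff_f = assms(2) and conv_f = assms(3) and smooth_f = assms(4)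
  note diff_g = assms(5) and conv_g = assms(6) and smooth_g = assms(7)
  define \<delta> where "\<delta> t = (if g (w t) \<le> \<epsilon> then f (w t) - f wstar else g (w t) - g wstar)" for t
  \<comment> \<open>For \<open>D = 0\<close> both summands of \<open>\<epsilon>\<close> vanish.
    Positivity of \<open>D\<close> keeps the step size positive when \<open>\<Delta>max\<close> is
    nonzero.\<close>
  have "D > 0"
    using \<open>\<epsilon> > 0\<close> \<open>D = norm (w1 - wstar)\<close> assms(17) by (cases "D = 0") auto
  have "real T > 0" using \<open>T \<ge> 1\<close> by simp
  have \<Delta>f: "f wstar - (INF x. f x) \<le> \<Delta>max" and \<Delta>g: "g wstar - (INF x. g x) \<le> \<Delta>max"
    using assms(10,12,13) by auto
  have "(INF x. f x) \<le> f wstar"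
    using assms(9) by (rule cINF_lower) simp
  then have "\<Delta>max \<ge> 0" using \<Delta>f by linarith
  note \<eta> = step_size_tolerance[OF \<open>L > 0\<close> \<open>D > 0\<close> \<open>\<Delta>max \<ge> 0\<close> \<open>real T > 0\<close> assms(17,18)]
  \<comment> \<open>In either branch the update is a gradient step on the very function whose gap
    \<open>\<delta> t\<close> records, and \<open>\<Delta>max\<close> serves for both.\<close>
  have step: "2 * \<eta> * (1 - \<eta> * L) * \<delta> t
      \<le> (norm (w t - wstar))\<^sup>2 - (norm (w (Suc t) - wstar))\<^sup>2 + 2 * \<eta>\<^sup>2 * L * \<Delta>max"
    if "t \<in> {1..T}" for t
    using that assms(19) \<eta>(1)
      gradient_step_progress[OF \<open>L > 0\<close> _ diff_f conv_f smooth_f assms(9) \<Delta>f, of \<eta> "w t"]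
      gradient_step_progress[OF \<open>L > 0\<close> _ diff_g conv_g smooth_g assms(11) \<Delta>g, of \<eta> "w t"]
    by (auto simp: \<delta>_def switching_gradient_iterates_def switching_direction_def)
  have "2 * \<eta> * (1 - \<eta> * L) * (\<Sum>t=1..T. \<delta> t)
      \<le> (\<Sum>t=1..T. ((norm (w t - wstar))\<^sup>2 - (norm (w (Suc t) - wstar))\<^sup>2) + 2 * \<eta>\<^sup>2 * L * \<Delta>max)"
    unfolding sum_distrib_left using step by (intro sum_mono) auto
  also have "\<dots> = ((norm (w 1 - wstar))\<^sup>2 - (norm (w (Suc T) - wstar))\<^sup>2) + 2 * \<eta>\<^sup>2 * L * \<Delta>max * real T"
    using sum_Suc_diff[of 1 T "\<lambda>t. - (norm (w t - wstar))\<^sup>2"] \<open>T \<ge> 1\<close>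
    by (simp add: sum.distrib)
  also have "\<dots> \<le> D\<^sup>2 + 2 * \<eta>\<^sup>2 * L * \<Delta>max * real T"
    using assms(15,19) by (simp add: switching_gradient_iterates_def)
  also have "\<dots> \<le> \<eta> * real T * \<epsilon>" by (rule \<eta>(3))
  finally have upper: "2 * (1 - \<eta> * L) * (\<Sum>t=1..T. \<delta> t) \<le> real T * \<epsilon>"
    using \<eta>(1) by (simp add: mult.assoc mult.left_commute[of _ \<eta>])
  have sum_le: "(\<Sum>t=1..T. \<delta> t) \<le> real T * \<epsilon>"
  proof (cases "(\<Sum>t=1..T. \<delta> t) \<ge> 0")
    case True
    then have "1 * (\<Sum>t=1..T. \<delta> t) \<le> 2 * (1 - \<eta> * L) * (\<Sum>t=1..T. \<delta> t)"
      using \<eta>(2) by (intro mult_right_mono) auto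
    then show ?thesis using upper by simp
  next
    case False
    moreover have "real T * \<epsilon> \<ge> 0" using \<open>\<epsilon> > 0\<close> by simp
    ultimately show ?thesis by linarith
  qed
  have A: "finite A" "A \<subseteq> {1..T}" using assms(20) by auto
  have "g wstar \<le> 0" using assms(8) by (simp add: is_arg_min_def)
  \<comment> \<open>Feasibility of \<open>wstar\<close> gives
    \<open>\<delta> t \<ge> g (w t)\<close> off \<open>A\<close>.\<close>
  then have off: "\<delta> t > \<epsilon>" if "t \<in> {1..T} - A" for t
    using that assms(20) by (auto simp: \<delta>_def)
  have "A \<noteq> {}"
  proof
    assume "A = {}"
    then have "(\<Sum>t=1..T. \<epsilon>) < (\<Sum>t=1..T. \<delta> t)"
      using off \<open>T \<ge> 1\<close> by (intro sum_strict_mono) auto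
    with sum_le show False by simp
  qed
  have "(\<Sum>t\<in>A. \<delta> t - \<epsilon>) \<le> 0"
  proof -
    have "(\<Sum>t=1..T. \<delta> t - \<epsilon>) = (\<Sum>t\<in>{1..T} - A. \<delta> t - \<epsilon>) + (\<Sum>t\<in>A. \<delta> t - \<epsilon>)"
      using A by (intro sum.subset_diff) auto
    moreover have "(\<Sum>t\<in>{1..T} - A. \<delta> t - \<epsilon>) \<ge> 0"
      using off by (intro sum_nonneg) (simp add: less_imp_le)
    moreover have "(\<Sum>t=1..T. \<delta> t - \<epsilon>) \<le> 0"
      using sum_le by (simp add: sum_subtractf)
    ultimately show ?thesis by linarith
  qed
  moreover have "(\<Sum>t\<in>A. \<delta> t - \<epsilon>) = (\<Sum>t\<in>A. f (w t) - (f wstar + \<epsilon>))"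
    using assms(20) by (intro sum.cong) (auto simp: \<delta>_def)
  ultimately have f_sum: "(\<Sum>t\<in>A. f (w t)) \<le> real (card A) * (f wstar + \<epsilon>)"
    by (simp add: sum_subtractf)
  \<comment> \<open>For the constraint, membership in \<open>A\<close> bounds every term
    separately.\<close>
  have g_sum: "(\<Sum>t\<in>A. g (w t)) \<le> real (card A) * \<epsilon>"
    using assms(20) by (intro sum_bounded_above) auto
  have "f wbar \<le> f wstar + \<epsilon>"
    unfolding assms(21) by (rule convex_on_average_le[OF conv_f A(1) \<open>A \<noteq> {}\<close> f_sum])
  moreover have "g wbar \<le> \<epsilon>"
    unfolding assms(21) by (rule convex_on_average_le[OF conv_g A(1) \<open>A \<noteq> {}\<close> g_sum])
  ultimately show ?thesis
    using A(1) \<open>A \<noteq> {}\<close> by (auto simp: eps_solution_def card_gt_0_iff)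
qed

end
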